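(* Let $\Lambda\subseteq\mathbb{Z}_{\ge 0}\times\mathbb{Z}_{\ge 0}$ contain at least one $(s,d)$ with $d$ even. For each $n$, let $S_n$ be a uniform random subset of $[0,n]$. Then, as $n\to\infty$, $$\mathbb{E}\bigl[\,|S_n|\;\big|\;\lambda(S_n)\in\Lambda\bigr]=\frac{n+1}{2}+O(\log n)$$ and $$\mathrm{Var}\bigl(|S_n|\;\big|\;\lambda(S_n)\in\Lambda\bigr)=\frac{n+1}{4}+O((\log n)^2),$$ where the constants in the big-$O$ may depend on $\Lambda$.
   Context: $[0,n]$ denotes $\{0,1,\dots,n\}$. For a finite set $S$ of integers, $S+S=\{s_1+s_2 : s_1,s_2\in S\}$ and $S-S=\{s_1-s_2 : s_1,s_2\in S\}$. For $S\subseteq[0,n]$, $\lambda(S)=\lambda_n(S)=(2n+1-|S+S|,\;2n+1-|S-S|)$. The conditional expectation and variance are those of $|S_n|$ under the conditional distribution of $S_n$ given the event $\lambda(S_n)\in\Lambda$; under the hypothesis on $\Lambda$ the probability of this event tends to a positive limit, so it is positive for all large $n$. *)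

theory Defs
  imports
    "HOL-Probability.Probability"
    "HOL-Library.Set_Algebras"
    "HOL-Library.Landau_Symbols"
begin

(* The sumset is A + A from Set_Algebras.  The difference set needs its own
   definition, because A - B on sets denotes the relative complement. *)

definition difference_set :: "int set \<Rightarrow> int set \<Rightarrow> int set" where
  "difference_set A B = {a - b | a b. a \<in> A \<and> b \<in> B}"

(* The numbers of elements of [0,2n] and of [-n,n] missing from A + A and from
   the difference set of A; both are nonnegative when A is a subset of [0,n]. *)

definition missing :: "nat \<Rightarrow> int set \<Rightarrow> int \<times> int" where
  "missing n A =
    (2 * int n + 1 - int (card (A + A)),
     2 * int n + 1 - int (card (difference_set A A)))"

definition random_subset :: "nat \<Rightarrow> int set pmf" where
  "random_subset n = pmf_of_set (Pow {0..int n})"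

(* When the conditioning event has probability 0, the value of cond_pmf is
   unspecified. *)

definition conditioned_subset :: "(int \<times> int) set \<Rightarrow> nat \<Rightarrow> int set pmf" where
  "conditioned_subset \<Lambda> n = cond_pmf (random_subset n) {A. missing n A \<in> \<Lambda>}"

end

theory Submission
  imports Defs
begin

text \<open>An element of [k, 2n - k] is missing from S + S, or one of [0, n - k] from S - S, only with
  probability O((7/8)^k), because each has at least k/2 disjoint representing pairs. Off this
  event the missing sums and differences are determined by the first and last k elements of S.
  With k of order log n the error is O(n^-3), and |S| splits into O(log n) fringe elements and an
  independent binomial middle part, whose centered moments are unaffected by the conditioning.
  It remains to bound the probability of the conditioning event from below, which is done by
  exhibiting fringes with any prescribed number s of missing sums and even number 2e of missing
  differences.\<close>

section \<open>Typical sums and differences are present\<close>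

text \<open>The parity of d matters because the difference set of a nonempty set contains 0 and is
  symmetric, so the number of missing differences is even; an odd d is attained by the empty set
  alone. A single admissible pair in \<open>\<Lambda>\<close> gives the event a positive density,
  and conditioning then magnifies any error measured against all 2^(n+1) subsets by a constant
  factor only. The rate n^-3 fits the second moment: |S| differs from (n+1)/2 by at most n, so the
  exceptional sets contribute a bounded amount to both moments. The fringe shifts the mean by an
  amount of order log n; the square of this shift and the squared deviation of the fringe itself are
  what put (log n)^2 into the variance. The obstacle in the lower bound is that fixing the fringes
  takes away elements that might represent middle sums and differences, so the estimate for a
  uniform set does not apply directly. Fringes that end in a full block remove it: then every
  element of a shifted typical set is retained.\<close>

lemma card_avoiding_le:
  fixes P :: "'i \<Rightarrow> 'a set"
  assumes "finite I" "finite U" "disjoint_family_on P I"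
    and "\<And>i. i \<in> I \<Longrightarrow> P i \<subseteq> U \<and> card (P i) \<le> 2"
  shows "real (card {A \<in> Pow U. \<forall>i\<in>I. \<not> P i \<subseteq> A}) \<le> (3/4) ^ card I * 2 ^ card U"
  using assms
proof (induction I arbitrary: U rule: finite_induct)
  case empty
  then show ?case by (simp add: card_Pow[unfolded Pow_def])
next
  case (insert i I)
  let ?V = "U - P i"
  let ?L = "{A \<in> Pow U. \<forall>j\<in>insert i I. \<not> P j \<subseteq> A}"
  let ?R = "{A \<in> Pow ?V. \<forall>j\<in>I. \<not> P j \<subseteq> A}"
  have Pi: "P i \<subseteq> U" "card (P i) \<le> 2" and fin: "finite (P i)"
    using insert.prems by (auto intro: finite_subset)
  have disj: "P i \<inter> P j = {}" if "j \<in> I" for j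
    using insert.prems(2) insert.hyps(2) that by (auto simp: disjoint_family_on_def)
  have IH: "real (card ?R) \<le> (3/4) ^ card I * 2 ^ card ?V"
  proof (rule insert.IH)
    show "finite ?V" using insert.prems(1) by simp
    show "disjoint_family_on P I"
      using insert.prems(2) by (auto simp: disjoint_family_on_def)
    show "P j \<subseteq> ?V \<and> card (P j) \<le> 2" if "j \<in> I" for j
      using insert.prems(3)[of j] disj[OF that] that by auto
  qed
  \<comment> \<open>Independence in counting form: the trace of A on \<open>P i\<close> is any
    proper subset, the rest is free of the other sets. Two points give the factor 3/4; a pair that
    collapses to one point gives only 1/2.\<close>
  have "card ?L \<le> card ((Pow (P i) - {P i}) \<times> ?R)"
  proof (rule card_inj_on_le)
    show "inj_on (\<lambda>A. (A \<inter> P i, A - P i)) ?L"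
      by (auto simp: inj_on_def)
    show "(\<lambda>A. (A \<inter> P i, A - P i)) ` ?L \<subseteq> (Pow (P i) - {P i}) \<times> ?R"
      using disj by (auto simp: subset_iff)
    show "finite ((Pow (P i) - {P i}) \<times> ?R)"
      using fin insert.prems(1) by simp
  qed
  also have "\<dots> = (2 ^ card (P i) - 1) * card ?R"
    using fin by (simp add: card_cartesian_product card_Pow card_Diff_subset)
  finally have "real (card ?L) \<le> real ((2 ^ card (P i) - 1) * card ?R)"
    by (rule of_nat_mono)
  also have "\<dots> = real (2 ^ card (P i) - 1) * real (card ?R)"
    by (rule of_nat_mult)
  also have "\<dots> \<le> (3/4 * 2 ^ card (P i)) * ((3/4) ^ card I * 2 ^ card ?V)"
  proof (intro mult_mono IH)
    have "card (P i) = 0 \<or> card (P i) = 1 \<or> card (P i) = 2"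
      using Pi(2) by linarith
    then show "real (2 ^ card (P i) - 1) \<le> 3/4 * 2 ^ card (P i)"
      by (elim disjE) simp_all
  qed simp_all
  also have "\<dots> = (3/4) ^ card (insert i I) * 2 ^ (card (P i) + card ?V)"
    using insert.hyps by (simp add: power_add)
  also have "card (P i) + card ?V = card U"
    using Pi(1) insert.prems(1) fin by (simp add: card_Diff_subset card_mono)
  finally show ?case .
qed

text \<open>The rate 7/8 originates here: 3/4 = 48/64 is just below (7/8)^2 = 49/64. The exponent
  j/2 of 3/4 thus becomes the exponent j, without rounding.\<close>

lemma three_quarters_power_le:
  assumes "j \<le> 2 * p"
  shows "(3/4 :: real) ^ p \<le> (7/8) ^ j"
proof -
  have "(3/4 :: real) ^ p \<le> ((7/8)\<^sup>2) ^ p"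
    by (intro power_mono) (simp_all add: power2_eq_square)
  also have "\<dots> = (7/8) ^ (2 * p)" by (simp add: power_mult)
  also have "\<dots> \<le> (7/8) ^ j" using assms by (intro power_decreasing) auto
  finally show ?thesis .
qed

lemma card_missing_sum_le:
  fixes m :: int
  assumes "int j \<le> m" "m \<le> 2 * int n - int j"
  shows "real (card {S \<in> Pow {0..int n}. m \<notin> S + S}) \<le> (7/8) ^ j * 2 ^ (n + 1)"
proof -
  \<comment> \<open>The lower end keeps m - i at most n, the upper end lists each unordered pair
    once, including the collapsed pair i = m - i. In both halves of the range at least (j + 1)/2
    indices remain.\<close>
  let ?I = "{max 0 (m - int n)..m div 2}"
  let ?P = "\<lambda>i. {i, m - i}"
  let ?R = "{S \<in> Pow {0..int n}. \<forall>i\<in>?I. \<not> ?P i \<subseteq> S}"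
  have "card {S \<in> Pow {0..int n}. m \<notin> S + S} \<le> card ?R"
  proof (rule card_mono)
    show "{S \<in> Pow {0..int n}. m \<notin> S + S} \<subseteq> ?R"
    proof safe
      fix S i assume *: "m \<notin> S + S" "?P i \<subseteq> S"
      then have "i + (m - i) \<in> S + S" by (intro set_plus_intro) auto
      with * show False by simp
    qed
  qed simp
  also have "real \<dots> \<le> (3/4) ^ card ?I * 2 ^ card {0..int n}"
  proof (rule card_avoiding_le)
    show "disjoint_family_on ?P ?I"
      by (auto simp: disjoint_family_on_def)
    show "?P i \<subseteq> {0..int n} \<and> card (?P i) \<le> 2" if "i \<in> ?I" for i
      using that by (auto simp: card_insert_if)
  qed simp_all
  also have "\<dots> \<le> (7/8) ^ j * 2 ^ (n + 1)"
  proof (rule mult_mono)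
    show "(3/4 :: real) ^ card ?I \<le> (7/8) ^ j"
      by (rule three_quarters_power_le) (use assms in auto)
  qed (simp_all add: nat_add_distrib)
  finally show ?thesis by simp
qed

text \<open>In contrast to sums, distinct representations of a difference d may share an element:
  when d is at most j, the pairs {i, i + d} link up into chains. Keeping a suitable half of them
  restores disjointness.\<close>

lemma card_missing_difference_le:
  assumes "j \<le> n"
  shows "real (card {S \<in> Pow {0..int n}. int n - int j \<notin> difference_set S S})
           \<le> (7/8) ^ j * 2 ^ (n + 1)"
proof -
  define d where "d = int n - int j"
  have d: "0 \<le> d" using assms by (simp add: d_def)
  \<comment> \<open>Alternate blocks of length d, so that the pairs {i, i + d} are disjoint;
    for d = 0 division by zero makes every index lie in the even block 0.\<close>
  let ?I = "{i \<in> {0..int j}. even (i div d)}"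
  let ?O = "{i \<in> {0..int j}. odd (i div d)}"
  let ?P = "\<lambda>i. {i, i + d}"
  let ?R = "{S \<in> Pow {0..int n}. \<forall>i\<in>?I. \<not> ?P i \<subseteq> S}"
  have shift: "even ((i + d) div d) \<longleftrightarrow> odd (i div d)" if "d \<noteq> 0" for i
    using that by simp
  have "card {S \<in> Pow {0..int n}. d \<notin> difference_set S S} \<le> card ?R"
  proof (rule card_mono)
    show "{S \<in> Pow {0..int n}. d \<notin> difference_set S S} \<subseteq> ?R"
    proof safe
      fix S i assume *: "d \<notin> difference_set S S" "?P i \<subseteq> S"
      then have "(i + d) - i \<in> difference_set S S" unfolding difference_set_def by blast
      with * show False by simp
    qed
  qed simp
  also have "real \<dots> \<le> (3/4) ^ card ?I * 2 ^ card {0..int n}"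
  proof (rule card_avoiding_le)
    show "disjoint_family_on ?P ?I"
      unfolding disjoint_family_on_def
    proof (intro ballI impI)
      fix x y assume xy: "x \<in> ?I" "y \<in> ?I" "x \<noteq> y"
      have "x \<noteq> y + d" "y \<noteq> x + d"
        using xy shift by (metis (mono_tags, lifting) add_0_right mem_Collect_eq)+
      with xy show "?P x \<inter> ?P y = {}" by auto
    qed
    show "?P i \<subseteq> {0..int n} \<and> card (?P i) \<le> 2" if "i \<in> ?I" for i
      using that d by (auto simp: card_insert_if d_def)
  qed (auto intro: finite_subset[of _ "{0..int j}"])
  also have "\<dots> \<le> (7/8) ^ j * 2 ^ (n + 1)"
  proof (rule mult_mono)
    \<comment> \<open>Every odd block follows a complete even block, so shifting back by d embeds
      the odd indices into the even ones. Hence the even blocks hold at least half of the j + 1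
      indices.\<close>
    have "card ?O \<le> card ?I"
    proof (rule card_inj_on_le)
      show "inj_on (\<lambda>i. i - d) ?O" by (simp add: inj_on_def)
      show "(\<lambda>i. i - d) ` ?O \<subseteq> ?I"
      proof clarify
        fix i assume i: "i \<in> {0..int j}" "odd (i div d)"
        then have dn: "d \<noteq> 0" by auto
        have "d \<le> i"
        proof (rule ccontr)
          assume "\<not> d \<le> i"
          then have "i div d = 0" using i by (simp add: div_pos_pos_trivial)
          with i show False by simp
        qed
        moreover have "even ((i - d) div d)" using shift[OF dn, of "i - d"] i by simp
        ultimately show "i - d \<in> {0..int j} \<and> even ((i - d) div d)"
          using i d by auto
      qed
    qed (auto intro: finite_subset[of _ "{0..int j}"])
    moreover have "card ?I + card ?O = card (?I \<union> ?O)"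
      by (rule card_Un_disjoint[symmetric]) (auto intro: finite_subset[of _ "{0..int j}"])
    moreover have "?I \<union> ?O = {0..int j}" by blast
    ultimately have "j \<le> 2 * card ?I" by simp
    then show "(3/4 :: real) ^ card ?I \<le> (7/8) ^ j"
      by (rule three_quarters_power_le)
  qed (simp_all add: nat_add_distrib)
  finally show ?thesis by (simp add: d_def)
qed

text \<open>Nonnegative differences suffice because a difference set is symmetric about 0.\<close>

definition well_spread :: "nat \<Rightarrow> nat \<Rightarrow> int set \<Rightarrow> bool" where
  "well_spread n k S \<longleftrightarrow>
    {int k..2 * int n - int k} \<subseteq> S + S \<and> {0..int n - int k} \<subseteq> difference_set S S"

lemma sum_geometric_le: "(\<Sum>j=k..n. (7/8 :: real) ^ j) \<le> 8 * (7/8) ^ k"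
proof (cases "k \<le> n")
  case True
  then have "(\<Sum>j=k..n. (7/8 :: real) ^ j) = 8 * ((7/8) ^ k - (7/8) ^ Suc n)"
    by (simp add: sum_gp)
  then show ?thesis by simp
qed simp

text \<open>Union bound over the distance j of the missing element from the end of its range. Each j
  accounts for two sums and one nonnegative difference, so the constant is 3 * 8 with 8 = 1 / (1 -
  7/8).\<close>

lemma card_not_well_spread_le:
  "real (card {S \<in> Pow {0..int n}. \<not> well_spread n k S}) \<le> 24 * (7/8) ^ k * 2 ^ (n + 1)"
proof -
  let ?s = "\<lambda>m. {S \<in> Pow {0..int n}. m \<notin> S + S}"
  let ?d = "\<lambda>m. {S \<in> Pow {0..int n}. m \<notin> difference_set S S}"
  let ?U = "\<lambda>j. ?s (int j) \<union> ?s (2 * int n - int j) \<union> ?d (int n - int j)"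
  have "{S \<in> Pow {0..int n}. \<not> well_spread n k S} \<subseteq> (\<Union>j\<in>{k..n}. ?U j)"
  proof
    fix S assume S: "S \<in> {S \<in> Pow {0..int n}. \<not> well_spread n k S}"
    then have "(\<exists>m. int k \<le> m \<and> m \<le> 2 * int n - int k \<and> m \<notin> S + S)
        \<or> (\<exists>m. 0 \<le> m \<and> m \<le> int n - int k \<and> m \<notin> difference_set S S)"
      by (auto simp: well_spread_def)
    then consider m where "int k \<le> m" "m \<le> 2 * int n - int k" "m \<notin> S + S"
      | m where "0 \<le> m" "m \<le> int n - int k" "m \<notin> difference_set S S"
      by blast
    then show "S \<in> (\<Union>j\<in>{k..n}. ?U j)"
    proof cases
      case 1
      show ?thesis
      proof (cases "m \<le> int n")
        case True
        with 1 S show ?thesis by (intro UN_I[of "nat m"]) auto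
      next
        case False
        with 1 S show ?thesis by (intro UN_I[of "nat (2 * int n - m)"]) auto
      qed
    next
      case 2
      with S show ?thesis by (intro UN_I[of "nat (int n - m)"]) auto
    qed
  qed
  then have "card {S \<in> Pow {0..int n}. \<not> well_spread n k S} \<le> card (\<Union>j\<in>{k..n}. ?U j)"
    by (intro card_mono) auto
  also have "\<dots> \<le> (\<Sum>j=k..n. card (?U j))"
    by (rule card_UN_le) simp
  finally have "real (card {S \<in> Pow {0..int n}. \<not> well_spread n k S})
      \<le> real (\<Sum>j=k..n. card (?U j))"
    by (rule of_nat_mono)
  also have "\<dots> = (\<Sum>j=k..n. real (card (?U j)))"
    by (rule of_nat_sum)
  also have "\<dots> \<le> (\<Sum>j=k..n. 3 * ((7/8) ^ j * 2 ^ (n + 1)))"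
  proof (rule sum_mono)
    fix j assume "j \<in> {k..n}"
    then have j: "j \<le> n" by simp
    have "card (?U j) \<le> card (?s (int j)) + card (?s (2 * int n - int j)) + card (?d (int n - int j))"
      by (meson card_Un_le add_le_mono1 le_trans)
    then have "real (card (?U j)) \<le> real (card (?s (int j))) + real (card (?s (2 * int n - int j)))
        + real (card (?d (int n - int j)))"
      by linarith
    moreover have "real (card (?s (int j))) \<le> (7/8) ^ j * 2 ^ (n + 1)"
      by (rule card_missing_sum_le) (use j in auto)
    moreover have "real (card (?s (2 * int n - int j))) \<le> (7/8) ^ j * 2 ^ (n + 1)"
      by (rule card_missing_sum_le) (use j in auto)
    ultimately show "real (card (?U j)) \<le> 3 * ((7/8) ^ j * 2 ^ (n + 1))"
      using card_missing_difference_le[OF j] by linarith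
  qed
  also have "\<dots> = 3 * 2 ^ (n + 1) * (\<Sum>j=k..n. (7/8) ^ j)"
    by (simp add: sum_distrib_left mult_ac)
  also have "\<dots> \<le> 3 * 2 ^ (n + 1) * (8 * (7/8) ^ k)"
    by (intro mult_left_mono sum_geometric_le) simp
  finally show ?thesis by (simp add: mult_ac)
qed

section \<open>Fringes\<close>

text \<open>\<open>A\<close> plays the role of S seen from 0, and \<open>B\<close> that of its
  reflection n - S, so that both ends start at 0. Then \<open>B + B\<close> records distances of
  sums from 2n and \<open>A + B\<close> distances of differences from n; the factor 2 accounts for
  the negative differences. No truncation at \<open>k\<close> is required of \<open>A\<close> and
  \<open>B\<close>.\<close>

definition fringe_missing :: "int \<Rightarrow> int set \<Rightarrow> int set \<Rightarrow> int \<times> int" where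
  "fringe_missing k A B =
    (int (card ({0..<k} - (A + A))) + int (card ({0..<k} - (B + B))),
     2 * int (card ({0..<k} - (A + B))))"

text \<open>A sum below k of nonnegative integers has both summands below k.\<close>

lemma fringe_missing_cong:
  assumes "A \<subseteq> {0..}" "B \<subseteq> {0..}" "A' \<subseteq> {0..}" "B' \<subseteq> {0..}"
    and "A \<inter> {..<k} = A' \<inter> {..<k}" "B \<inter> {..<k} = B' \<inter> {..<k}"
  shows "fringe_missing k A B = fringe_missing k A' B'"
proof -
  have *: "{0..<k} - (X + Y) = {0..<k} - (X' + Y')"
    if "X \<subseteq> {0..}" "Y \<subseteq> {0..}" "X' \<subseteq> {0..}" "Y' \<subseteq> {0..}"
      "X \<inter> {..<k} = X' \<inter> {..<k}" "Y \<inter> {..<k} = Y' \<inter> {..<k}" for X Y X' Y'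
  proof -
    have "X + Y \<subseteq> (X' + Y') \<union> {k..}"
      if *: "X \<subseteq> {0..}" "Y \<subseteq> {0..}" "X \<inter> {..<k} = X' \<inter> {..<k}" "Y \<inter> {..<k} = Y' \<inter> {..<k}"
      for X Y X' Y'
    proof
      fix z assume "z \<in> X + Y"
      then obtain x y where z: "z = x + y" "x \<in> X" "y \<in> Y" by (auto elim: set_plus_elim)
      show "z \<in> (X' + Y') \<union> {k..}"
      proof (cases "z < k")
        case True
        with z * have "x < k" "y < k" by force+
        with z * have "x \<in> X'" "y \<in> Y'" by blast+
        with z show ?thesis by auto
      qed simp
    qed
    then have "X + Y \<subseteq> (X' + Y') \<union> {k..}" "X' + Y' \<subseteq> (X + Y) \<union> {k..}"
      using that by simp_all
    then show ?thesis by fastforce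
  qed
  show ?thesis unfolding fringe_missing_def
    using *[of A A A' A'] *[of B B B' B'] *[of A B A' B'] assms by simp
qed

text \<open>A well spread set can lack only sums at distance less than k from 0 or 2n, and
  differences at distance less than k from n or -n. The reflection x to n - x moves the upper ends
  to 0, and \<open>k \<le> n\<close> keeps the two ends disjoint in both counts.\<close>

lemma missing_eq_fringe_missing:
  assumes S: "S \<subseteq> {0..int n}" and "k \<le> n" and "well_spread n k S"
  shows "missing n S = fringe_missing (int k) S ((\<lambda>x. int n - x) ` S)"
proof -
  let ?R = "(\<lambda>x. int n - x) ` S" and ?D = "difference_set S S"
  let ?L1 = "{0..<int k} - (S + S)" and ?L2 = "{0..<int k} - (?R + ?R)"
  let ?L3 = "{0..<int k} - (S + ?R)"
  have ws: "m \<in> S + S" if "int k \<le> m" "m \<le> 2 * int n - int k" for m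
    using that assms(3) by (auto simp: well_spread_def)
  have wd: "m \<in> ?D" if "0 \<le> m" "m \<le> int n - int k" for m
    using that assms(3) by (auto simp: well_spread_def)
  have "- m \<in> ?D" if "m \<in> ?D" for m
    using that by (auto simp: difference_set_def) blast
  from this have D_neg: "- m \<in> ?D \<longleftrightarrow> m \<in> ?D" for m
    by (metis minus_minus)
  have R: "2 * int n - x \<in> S + S \<longleftrightarrow> x \<in> ?R + ?R" for x
  proof
    assume "2 * int n - x \<in> S + S"
    then obtain a b where "2 * int n - x = a + b" "a \<in> S" "b \<in> S" by (auto elim: set_plus_elim)
    then have "x = (int n - a) + (int n - b)" "int n - a \<in> ?R" "int n - b \<in> ?R" by auto
    then show "x \<in> ?R + ?R" by (metis set_plus_intro)
  next
    assume "x \<in> ?R + ?R"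
    then obtain a b where "x = (int n - a) + (int n - b)" "a \<in> S" "b \<in> S"
      by (auto elim!: set_plus_elim)
    then have "2 * int n - x = a + b" "a \<in> S" "b \<in> S" by auto
    then show "2 * int n - x \<in> S + S" by (metis set_plus_intro)
  qed
  have D: "int n - x \<in> ?D \<longleftrightarrow> x \<in> S + ?R" for x
  proof
    assume "int n - x \<in> ?D"
    then obtain a b where "int n - x = a - b" "a \<in> S" "b \<in> S" by (auto simp: difference_set_def)
    then have "x = b + (int n - a)" "b \<in> S" "int n - a \<in> ?R" by auto
    then show "x \<in> S + ?R" by (metis set_plus_intro)
  next
    assume "x \<in> S + ?R"
    then obtain a b where "x = b + (int n - a)" "a \<in> S" "b \<in> S"
      by (auto elim!: set_plus_elim)
    then show "int n - x \<in> ?D" unfolding difference_set_def by force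
  qed
  have "S + S \<subseteq> {0..2 * int n}" 
    by (rule order_trans[OF set_plus_mono2[OF S S]]) (auto elim!: set_plus_elim)
  then have "int (card {0..2 * int n}) - int (card (S + S)) = int (card ({0..2 * int n} - (S + S)))"
    by (metis (no_types, lifting) card_Diff_subset card_mono finite_atLeastAtMost_int finite_subset of_nat_diff)
  also have "{0..2 * int n} - (S + S) = ?L1 \<union> (\<lambda>x. 2 * int n - x) ` ?L2"
  proof (intro equalityI subsetI)
    fix m assume m: "m \<in> {0..2 * int n} - (S + S)"
    then have "m < int k \<or> 2 * int n - int k < m" using ws[of m] by (meson DiffD2 not_le)
    then show "m \<in> ?L1 \<union> (\<lambda>x. 2 * int n - x) ` ?L2"
    proof
      assume "2 * int n - int k < m"
      moreover have "2 * int n - m \<notin> ?R + ?R" using m R[of "2 * int n - m"] by simp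
      ultimately have "2 * int n - m \<in> ?L2" using m by auto
      then show ?thesis by (intro UnI2 image_eqI[of _ _ "2 * int n - m"]) auto
    qed (use m in auto)
  next
    fix m assume "m \<in> ?L1 \<union> (\<lambda>x. 2 * int n - x) ` ?L2"
    then show "m \<in> {0..2 * int n} - (S + S)" using R \<open>k \<le> n\<close> by auto
  qed
  also have "card \<dots> = card ?L1 + card ((\<lambda>x. 2 * int n - x) ` ?L2)"
    by (rule card_Un_disjoint) (use \<open>k \<le> n\<close> in auto)
  also have "card ((\<lambda>x. 2 * int n - x) ` ?L2) = card ?L2"
    by (rule card_image) (simp add: inj_on_def)
  finally have 1: "2 * int n + 1 - int (card (S + S)) = int (card ?L1) + int (card ?L2)"
    by simp
  have "?D \<subseteq> {- int n..int n}"
  proof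
    fix m assume "m \<in> ?D"
    then obtain a b where m: "m = a - b" "a \<in> S" "b \<in> S" by (auto simp: difference_set_def)
    with S have "a \<in> {0..int n}" "b \<in> {0..int n}" by blast+
    with m(1) show "m \<in> {- int n..int n}" by auto
  qed
  then have "int (card {- int n..int n}) - int (card ?D) = int (card ({- int n..int n} - ?D))"
    by (metis (no_types, lifting) card_Diff_subset card_mono finite_atLeastAtMost_int finite_subset of_nat_diff)
  also have "{- int n..int n} - ?D = (\<lambda>x. int n - x) ` ?L3 \<union> (\<lambda>x. x - int n) ` ?L3"
  proof (intro equalityI subsetI)
    fix m assume m: "m \<in> {- int n..int n} - ?D"
    show "m \<in> (\<lambda>x. int n - x) ` ?L3 \<union> (\<lambda>x. x - int n) ` ?L3"
    proof (cases "0 \<le> m")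
      case True
      then have "int n - m \<in> ?L3" using m wd[of m] D[of "int n - m"] by force
      then show ?thesis by (intro UnI1 image_eqI[of _ _ "int n - m"]) auto
    next
      case False
      then have "int n + m \<in> ?L3" using m wd[of "- m"] D[of "int n + m"] D_neg[of m] by force
      then show ?thesis by (intro UnI2 image_eqI[of _ _ "int n + m"]) auto
    qed
  next
    fix m assume "m \<in> (\<lambda>x. int n - x) ` ?L3 \<union> (\<lambda>x. x - int n) ` ?L3"
    then obtain x where x: "x \<in> ?L3" "m = int n - x \<or> m = - (int n - x)" by fastforce
    then have "m \<notin> ?D" using D[of x] D_neg[of "int n - x"] by auto
    with x \<open>k \<le> n\<close> show "m \<in> {- int n..int n} - ?D" by auto
  qed
  also have "card \<dots> = card ((\<lambda>x. int n - x) ` ?L3) + card ((\<lambda>x. x - int n) ` ?L3)"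
    by (rule card_Un_disjoint) (use \<open>k \<le> n\<close> in auto)
  also have "card ((\<lambda>x. int n - x) ` ?L3) = card ?L3"
    by (rule card_image) (simp add: inj_on_def)
  also have "card ((\<lambda>x. x - int n) ` ?L3) = card ?L3"
    by (rule card_image) (simp add: inj_on_def)
  finally have 2: "2 * int n + 1 - int (card ?D) = 2 * int (card ?L3)"
    by simp
  show ?thesis using 1 2 by (simp add: missing_def fringe_missing_def)
qed

text \<open>Below the threshold M, the set A consists of the multiples of 3 together with
  1 and 3w + 2, so that A + A lacks exactly 5, 8, ..., 3w - 1, while B avoids the residue 2
  and is empty on the second half of the range. A residue 2 in A + B then comes from 1
  or from 3w + 2 in A, and this fails exactly for the e largest values below M.\<close>

lemma fringe_missing_surj:
  fixes s e :: nat
  obtains M :: nat and A B :: "int set" where "A \<subseteq> {0..}" "B \<subseteq> {0..}"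
    "{int M..} \<subseteq> A" "{int M..} \<subseteq> B"
    "\<And>k. k \<ge> int M \<Longrightarrow> fringe_missing k A B = (int s, 2 * int e)"
proof -
  \<comment> \<open>The interval from 1 to w - 1 has s elements. In \<open>A + B\<close>, a number
    3t + 2 below M is reached through 1 when t < j and through 3w + 2 when w \<le> t < j + w.
    Quotients below j add up to at most 2(j - 1), so \<open>B + B\<close> reaches everything below M
    = 3(2j - 1). Exactly e quotients from j + w to 2j - 2 stay unreached when j = e + w + 1.\<close>
  define w j M where "w = int s + 1" and "j = int e + w + 1" and "M = 3 * (2 * int e + 2 * w + 1)"
  note defs = w_def j_def M_def
  define A where "A = {1, 3 * w + 2} \<union> {x. 0 \<le> x \<and> x mod 3 = 0} \<union> {M..}"
  define B where "B = {x. 0 \<le> x \<and> x < 3 * j \<and> x mod 3 \<noteq> 2} \<union> {M..}"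
  have pos: "w \<ge> 1" "j \<ge> 1" "M \<ge> 0" by (simp_all add: defs)
  have nonneg: "A \<subseteq> {0..}" "B \<subseteq> {0..}" using pos by (auto simp: A_def B_def)
  have AA: "{0..<k} - (A + A) = (\<lambda>t. 3 * t + 2) ` {1..<w}" if k: "k \<ge> M" for k
  proof (intro equalityI subsetI)
    fix x assume x: "x \<in> {0..<k} - (A + A)"
    have no: "x \<noteq> a + b" if "a \<in> A" "b \<in> A" for a b using x that by auto
    have "x mod 3 \<noteq> 0" using no[of x 0] x by (auto simp: A_def)
    moreover have "x mod 3 \<noteq> 1"
    proof
      assume "x mod 3 = 1"
      then have "(x - 1) mod 3 = 0" "x \<ge> 1" using x by (presburger, cases "x = 0", auto)
      with no[of 1 "x - 1"] show False by (auto simp: A_def)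
    qed
    ultimately have x3: "x mod 3 = 2" by presburger
    then have "x \<noteq> 2" using no[of 1 1] by (auto simp: A_def)
    moreover have "x < 3 * w + 2"
    proof (rule ccontr)
      assume "\<not> x < 3 * w + 2"
      moreover have "(x - (3 * w + 2)) mod 3 = 0" using x3 by presburger
      ultimately show False using no[of "3 * w + 2" "x - (3 * w + 2)"] by (auto simp: A_def)
    qed
    ultimately show "x \<in> (\<lambda>t. 3 * t + 2) ` {1..<w}"
      using x x3 by (intro image_eqI[of _ _ "x div 3"]) (auto, presburger+)
  next
    fix x assume "x \<in> (\<lambda>t. 3 * t + 2) ` {1..<w}"
    then obtain t where t: "x = 3 * t + 2" "1 \<le> t" "t < w" by auto
    have "x \<notin> A + A"
    proof
      assume "x \<in> A + A"
      then obtain a b where ab: "x = a + b" "a \<in> A" "b \<in> A" by (auto elim: set_plus_elim)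
      with nonneg have "0 \<le> a" "0 \<le> b" by auto
      with ab t have "a < 3 * w + 2" "b < 3 * w + 2" by auto
      with ab t have "a = 1 \<or> a mod 3 = 0" "b = 1 \<or> b mod 3 = 0" by (auto simp: A_def defs)
      \<comment> \<open>Summands that are 1 or divisible by 3 reach residue 2 only as 1 + 1, which
        is excluded by \<open>1 \<le> t\<close>.\<close>
      with ab t show False by presburger
    qed
    with t k show "x \<in> {0..<k} - (A + A)" by (auto simp: defs)
  qed
  have BB: "{0..<k} - (B + B) = {}" for k
  proof -
    have "x \<in> B + B" if x: "0 \<le> x" for x
    proof -
      \<comment> \<open>Below M, split the quotient of x into u and t - u, both less than j, and its
        residue into two numbers from {0, 1}; residue 2 becomes 1 + 1.\<close>
      define t where "t = x div 3"
      define u where "u = min t (j - 1)"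
      define r where "r = (if x mod 3 = 0 then 0 else 1 :: int)"
      have t: "0 \<le> t" "x = 3 * t + x mod 3" "x mod 3 < 3" "x mod 3 \<ge> 0"
        using x by (auto simp: t_def)
      show ?thesis
      proof (cases "x < M")
        case True
        then have tj: "t \<le> 2 * (j - 1)" using t by (simp add: defs)
        have "3 * u + r \<in> B" "3 * (t - u) + (x mod 3 - r) \<in> B"
          using tj t pos by (auto simp: B_def u_def r_def min_def) presburger+
        moreover have "x = (3 * u + r) + (3 * (t - u) + (x mod 3 - r))" using t by simp
        ultimately show ?thesis by (metis set_plus_intro)
      next
        case False
        then have "x + 0 \<in> B + B" by (intro set_plus_intro) (use pos in \<open>auto simp: B_def\<close>)
        then show ?thesis by simp
      qed
    qed
    then show ?thesis by auto
  qed
  have AB: "{0..<k} - (A + B) = (\<lambda>t. 3 * t + 2) ` {j + w..<j + w + int e}" if k: "k \<ge> M" for k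
  proof (intro equalityI subsetI)
    fix x assume x: "x \<in> {0..<k} - (A + B)"
    have no: "x \<noteq> a + b" if "a \<in> A" "b \<in> B" for a b using x that by auto
    have "x mod 3 \<noteq> 0" using no[of x 0] x pos by (auto simp: A_def B_def)
    moreover have "x mod 3 \<noteq> 1"
    proof
      assume "x mod 3 = 1"
      then have "(x - 1) mod 3 = 0" "x \<ge> 1" using x by (presburger, cases "x = 0", auto)
      with no[of "x - 1" 1] pos show False by (auto simp: A_def B_def)
    qed
    ultimately have x3: "x mod 3 = 2" by presburger
    have "x \<notin> B" using no[of 0 x] by (auto simp: A_def)
    then have "x < M" by (auto simp: B_def)
    have ge: "x \<ge> 3 * (j + w)"
    proof (rule ccontr)
      assume less: "\<not> x \<ge> 3 * (j + w)"
      show False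
      proof (cases "x < 3 * j")
        case True
        have "(x - 1) mod 3 = 1" "x \<ge> 1" using x3 x by (presburger, cases "x = 0", auto)
        with no[of 1 "x - 1"] True show False by (auto simp: A_def B_def)
      next
        case False
        \<comment> \<open>Now 3j \<le> x < 3(j + w), and j > w, so the remainder is nonnegative and
          below 3j, hence in \<open>B\<close>.\<close>
        have "(x - (3 * w + 2)) mod 3 = 0" using x3 by presburger
        with no[of "3 * w + 2" "x - (3 * w + 2)"] False less show False
          by (auto simp: A_def B_def defs)
      qed
    qed
    with x x3 \<open>x < M\<close> show "x \<in> (\<lambda>t. 3 * t + 2) ` {j + w..<j + w + int e}"
      by (intro image_eqI[of _ _ "x div 3"]) (auto simp: defs, presburger+)
  next
    fix x assume "x \<in> (\<lambda>t. 3 * t + 2) ` {j + w..<j + w + int e}"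
    then obtain t where t: "x = 3 * t + 2" "j + w \<le> t" "t < j + w + int e" by auto
    then have xM: "x < M" by (simp add: defs)
    have "x \<notin> A + B"
    proof
      assume "x \<in> A + B"
      then obtain a b where ab: "x = a + b" "a \<in> A" "b \<in> B" by (auto elim: set_plus_elim)
      with nonneg have "0 \<le> a" "0 \<le> b" by auto
      with ab xM have "a < M" "b < M" by auto
      with ab have a: "a = 1 \<or> a = 3 * w + 2 \<or> a mod 3 = 0" and b: "b < 3 * j" "b mod 3 \<noteq> 2"
        by (auto simp: A_def B_def)
      have "(a + b) mod 3 = 2" unfolding ab(1)[symmetric] t(1) by simp
      then have "a mod 3 \<noteq> 0" using b(2) by presburger
      with a ab(1) t b(1) pos show False by linarith
    qed
    with t k xM show "x \<in> {0..<k} - (A + B)" using pos by auto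
  qed
  show thesis
  proof
    show "A \<subseteq> {0..}" "B \<subseteq> {0..}" by (fact nonneg)+
    show "{int (nat M)..} \<subseteq> A" "{int (nat M)..} \<subseteq> B" using pos by (auto simp: A_def B_def)
    have "card ((\<lambda>t. 3 * t + 2 :: int) ` T) = card T" for T
      by (rule card_image) (simp add: inj_on_def)
    then show "fringe_missing k A B = (int s, 2 * int e)" if "k \<ge> int (nat M)" for k
      using that pos by (simp add: fringe_missing_def AA AB BB) (simp add: w_def)
  qed
qed

text \<open>A typical subset of a shorter interval is enlarged at both ends by the prescribed
  fringes. Filling in the two blocks that the fringes contain only enlarges the sumset and the
  difference set, and costs a bounded factor in the count.\<close>

lemma card_missing_eq_ge:
  fixes s e :: nat
  obtains c :: real and n0 :: nat where "c > 0"
    "\<And>n. n \<ge> n0 \<Longrightarrow>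
      c * 2 ^ (n + 1) \<le> real (card {S \<in> Pow {0..int n}. missing n S = (int s, 2 * int e)})"
proof -
  obtain M :: nat and A B :: "int set" where nonneg: "A \<subseteq> {0..}" "B \<subseteq> {0..}"
    and full: "{int M..} \<subseteq> A" "{int M..} \<subseteq> B"
    and fringe: "\<And>k. k \<ge> int M \<Longrightarrow> fringe_missing k A B = (int s, 2 * int e)"
    using fringe_missing_surj[of s e] by metis
  \<comment> \<open>With 24 * (1/48) = 1/2, at least half of all sets are well spread with this
    fixed k.\<close>
  obtain k where k: "(7/8 :: real) ^ k < 1/48"
    using real_arch_pow_inv[of "1/48" "7/8 :: real"] by auto
  \<comment> \<open>Shifting by M moves sums by 2M and leaves differences alone, while n exceeds N
    by 2M. Both presence ranges of T for k therefore become exactly those of the enlarged set for 2M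
    + k.\<close>
  define K where "K = 2 * M + k"
  show thesis
  proof
    \<comment> \<open>The factor 2^(2K) bounds the information about T that the fringes overwrite.
      The other is 2^(2M) for passing from n to N, times 2 for the discarded half of the
      sets.\<close>
    show "(1 / (2 ^ (2 * M + 1) * 2 ^ (2 * K)) :: real) > 0" by simp
    fix n assume n: "n \<ge> 2 * K"
    define N where "N = n - 2 * M"
    have N: "int N = int n - 2 * int M" and Nn: "n + 1 = N + (2 * M + 1)"
      using n by (simp_all add: N_def K_def of_nat_diff)
    define \<Phi> where "\<Phi> T = (A \<inter> {..<int K}) \<union> (\<lambda>x. x + int M) ` T \<inter> {int K..int n - int K}
      \<union> (\<lambda>x. int n - x) ` (B \<inter> {..<int K})" for T
    define good where "good = {T \<in> Pow {0..int N}. well_spread N k T}"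
    define bad where "bad = {T \<in> Pow {0..int N}. \<not> well_spread N k T}"
    let ?G = "{S \<in> Pow {0..int n}. missing n S = (int s, 2 * int e)}"
    \<comment> \<open>The elements of the short interval that the shift by M puts into the fringes.
      \<open>\<Phi> T\<close> forgets the trace of T there, so \<open>\<Phi> T\<close> together with
      this trace determines T.\<close>
    let ?W = "{0..<int K - int M} \<union> {int N - (int K - int M)<..int N}"
    have \<Phi>_mem: "\<Phi> T \<in> ?G" if "T \<in> good" for T
    proof -
      have T: "T \<subseteq> {0..int N}" and ws: "well_spread N k T"
        using that by (auto simp: good_def)
      have sub: "\<Phi> T \<subseteq> {0..int n}"
        using nonneg n by (auto simp: \<Phi>_def)
      have shift: "x + int M \<in> \<Phi> T" if "x \<in> T" for x
      proof -
        have x: "0 \<le> x" "x \<le> int n - 2 * int M" using that T N by auto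
        consider "x + int M < int K" | "x + int M > int n - int K"
          | "x + int M \<in> {int K..int n - int K}" by fastforce
        then show ?thesis
        proof cases
          case 1
          with x full show ?thesis by (auto simp: \<Phi>_def)
        next
          case 2
          with x full have "int n - (x + int M) \<in> B \<inter> {..<int K}" by auto
          then have "int n - (int n - (x + int M)) \<in> (\<lambda>x. int n - x) ` (B \<inter> {..<int K})"
            by (rule imageI)
          then show ?thesis by (simp add: \<Phi>_def)
        next
          case 3
          with that show ?thesis by (auto simp: \<Phi>_def)
        qed
      qed
      have "well_spread n K (\<Phi> T)"
        unfolding well_spread_def
      proof (intro conjI subsetI)
        fix m assume "m \<in> {int K..2 * int n - int K}"
        then have "m - 2 * int M \<in> T + T"
          using ws N by (auto simp: well_spread_def K_def)
        then obtain x y where "m - 2 * int M = x + y" "x \<in> T" "y \<in> T"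
          by (auto elim: set_plus_elim)
        then have "m = (x + int M) + (y + int M)" "x + int M \<in> \<Phi> T" "y + int M \<in> \<Phi> T"
          using shift by auto
        then show "m \<in> \<Phi> T + \<Phi> T" by (metis set_plus_intro)
      next
        fix m assume "m \<in> {0..int n - int K}"
        then have "m \<in> difference_set T T"
          using ws N by (auto simp: well_spread_def K_def)
        then obtain x y where "m = x - y" "x \<in> T" "y \<in> T"
          by (auto simp: difference_set_def)
        then have "m = (x + int M) - (y + int M)" "x + int M \<in> \<Phi> T" "y + int M \<in> \<Phi> T"
          using shift by auto
        then show "m \<in> difference_set (\<Phi> T) (\<Phi> T)" unfolding difference_set_def by blast
      qed
      then have "missing n (\<Phi> T)
          = fringe_missing (int K) (\<Phi> T) ((\<lambda>x. int n - x) ` \<Phi> T)"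
        using missing_eq_fringe_missing[OF sub] n by simp
      also have "\<dots> = fringe_missing (int K) A B"
      proof (rule fringe_missing_cong)
        show "\<Phi> T \<inter> {..<int K} = A \<inter> {..<int K}"
          using n by (auto simp: \<Phi>_def)
        have "(\<lambda>x. int n - x) ` \<Phi> T = (\<lambda>x. int n - x) ` (A \<inter> {..<int K})
          \<union> (\<lambda>x. int n - x) ` ((\<lambda>x. x + int M) ` T \<inter> {int K..int n - int K})
          \<union> B \<inter> {..<int K}"
          by (simp add: \<Phi>_def image_Un image_image)
        then show "(\<lambda>x. int n - x) ` \<Phi> T \<inter> {..<int K} = B \<inter> {..<int K}"
          using n by auto
      qed (use nonneg sub in auto)
      also have "\<dots> = (int s, 2 * int e)" by (rule fringe) (simp add: K_def)
      finally show ?thesis using sub by simp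
    qed
    have "card good \<le> card (?G \<times> Pow ?W)"
    proof (rule card_inj_on_le)
      show "inj_on (\<lambda>T. (\<Phi> T, T \<inter> ?W)) good"
      proof (rule inj_onI)
        fix T T' assume T: "T \<in> good" "T' \<in> good" and eq: "(\<Phi> T, T \<inter> ?W) = (\<Phi> T', T' \<inter> ?W)"
        have mem: "x \<in> T \<longleftrightarrow> x + int M \<in> \<Phi> T" if "x \<notin> ?W" "x \<in> {0..int N}" for x T
          using that N n by (auto simp: \<Phi>_def)
        have "x \<in> T \<longleftrightarrow> x \<in> T'" for x
        proof (cases "x \<in> {0..int N}")
          case True
          show ?thesis
          proof (cases "x \<in> ?W")
            case False
            with True mem eq show ?thesis by (metis Pair_inject)
          qed (use eq in blast)
        qed (use T in \<open>auto simp: good_def\<close>)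
        then show "T = T'" by blast
      qed
      show "(\<lambda>T. (\<Phi> T, T \<inter> ?W)) ` good \<subseteq> ?G \<times> Pow ?W"
        using \<Phi>_mem by blast
      show "finite (?G \<times> Pow ?W)" by simp
    qed
    also have "\<dots> = card ?G * 2 ^ card ?W"
      by (subst card_cartesian_product, subst card_Pow) auto
    also have "card ?W \<le> 2 * K"
      by (rule order_trans[OF card_Un_le]) simp
    then have "card ?G * 2 ^ card ?W \<le> card ?G * 2 ^ (2 * K)"
      by (intro mult_left_mono power_increasing) auto
    finally have "card good \<le> card ?G * 2 ^ (2 * K)" .
    then have "real (card good) \<le> real (card ?G * 2 ^ (2 * K))" by (rule of_nat_mono)
    then have upper: "real (card good) \<le> real (card ?G) * 2 ^ (2 * K)"
      by (simp only: of_nat_mult of_nat_power of_nat_numeral)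
    have "card good + card bad = card (good \<union> bad)"
      by (rule card_Un_disjoint[symmetric]) (auto simp: good_def bad_def)
    also have "good \<union> bad = Pow {0..int N}" by (auto simp: good_def bad_def)
    finally have "card good + card bad = 2 ^ (N + 1)"
      by (simp add: card_Pow nat_add_distrib)
    then have "real (card good) + real (card bad) = 2 ^ (N + 1)"
      by (metis of_nat_add of_nat_numeral of_nat_power)
    moreover have "real (card bad) \<le> 24 * (7/8) ^ k * 2 ^ (N + 1)"
      unfolding bad_def by (rule card_not_well_spread_le)
    moreover have "24 * (7/8) ^ k * 2 ^ (N + 1) \<le> (1/2) * (2 ^ (N + 1) :: real)"
      using k by (intro mult_right_mono) auto
    moreover have "(2 :: real) ^ (N + 1) = 2 * 2 ^ N" by simp
    ultimately have "2 ^ N \<le> real (card ?G) * 2 ^ (2 * K)" using upper by linarith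
    then have "2 ^ (n + 1) \<le> real (card ?G) * 2 ^ (2 * K) * 2 ^ (2 * M + 1)"
      unfolding Nn power_add[of _ N] by (intro mult_right_mono) auto
    then show "1 / (2 ^ (2 * M + 1) * 2 ^ (2 * K)) * 2 ^ (n + 1) \<le> real (card ?G)"
      by (simp add: divide_le_eq mult_ac)
  qed
qed

section \<open>Moments\<close>

lemma sum_Pow_Un:
  fixes g :: "'a set \<Rightarrow> 'a set \<Rightarrow> real"
  assumes "finite F" "finite M" "F \<inter> M = {}"
  shows "(\<Sum>A\<in>Pow (F \<union> M). g (A \<inter> F) (A \<inter> M)) = (\<Sum>P\<in>Pow F. \<Sum>Q\<in>Pow M. g P Q)"
proof -
  have "(\<Sum>P\<in>Pow F. \<Sum>Q\<in>Pow M. g P Q) = (\<Sum>(P, Q)\<in>Pow F \<times> Pow M. g P Q)"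
    by (rule sum.cartesian_product)
  also have "\<dots> = (\<Sum>A\<in>Pow (F \<union> M). g (A \<inter> F) (A \<inter> M))"
    by (rule sum.reindex_bij_witness[of _ "\<lambda>A. (A \<inter> F, A \<inter> M)" "\<lambda>(P, Q). P \<union> Q"])
      (use assms(3) in \<open>auto intro!: arg_cong2[of _ _ _ _ g]\<close>)
  finally show ?thesis by simp
qed

lemma sum_Pow_insert:
  fixes g :: "'a set \<Rightarrow> real"
  assumes "finite M" "x \<notin> M"
  shows "(\<Sum>Q\<in>Pow (insert x M). g Q) = (\<Sum>Q\<in>Pow M. g Q + g (insert x Q))"
proof -
  have "(\<Sum>Q\<in>Pow (insert x M). g Q) = (\<Sum>Q\<in>Pow M. g Q) + (\<Sum>Q\<in>insert x ` Pow M. g Q)"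
    unfolding Pow_insert using assms by (intro sum.union_disjoint) auto
  also have "(\<Sum>Q\<in>insert x ` Pow M. g Q) = (\<Sum>Q\<in>Pow M. g (insert x Q))"
    by (subst sum.reindex) (use assms(2) in \<open>auto simp: inj_on_def\<close>)
  finally show ?thesis by (simp add: sum.distrib)
qed

text \<open>These are the centered binomial moments before division by 2^m, m being the size of the
  set. If Q has deviation y, adjoining a point to the ground set turns it into the two deviations y
  - 1/2 and y + 1/2, with sum 2y and sum of squares 2y^2 + 1/2.\<close>

lemma sum_Pow_card_centered:
  fixes M :: "'a set"
  assumes "finite M"
  shows "(\<Sum>Q\<in>Pow M. real (card Q) - card M / 2) = 0"
    and "(\<Sum>Q\<in>Pow M. (real (card Q) - card M / 2)\<^sup>2) = card M / 4 * 2 ^ card M"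
proof -
  have card: "card (insert x Q) = card Q + 1" if "finite M" "x \<notin> M" "Q \<in> Pow M" for x Q M
    using that by (metis PowD Suc_eq_plus1 card_insert_disjoint finite_subset subsetD)
  show "(\<Sum>Q\<in>Pow M. real (card Q) - card M / 2) = 0"
    using assms
  proof induction
    case (insert x M)
    have "(\<Sum>Q\<in>Pow (insert x M). real (card Q) - card (insert x M) / 2)
        = (\<Sum>Q\<in>Pow M. 2 * (real (card Q) - card M / 2))"
      unfolding sum_Pow_insert[OF insert.hyps(1,2)]
    proof (rule sum.cong)
      fix Q assume "Q \<in> Pow M"
      then have "real (card (insert x Q)) = real (card Q) + 1" "real (card (insert x M)) = real (card M) + 1"
        using card[OF insert.hyps(1,2)] insert.hyps by auto
      then show "real (card Q) - card (insert x M) / 2 + (real (card (insert x Q)) - card (insert x M) / 2)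
          = 2 * (real (card Q) - card M / 2)"
        by (simp only:) (simp add: field_simps)
    qed simp
    also have "\<dots> = 0" unfolding sum_distrib_left[symmetric] insert.IH by simp
    finally show ?case .
  qed simp
  show "(\<Sum>Q\<in>Pow M. (real (card Q) - card M / 2)\<^sup>2) = card M / 4 * 2 ^ card M"
    using assms
  proof induction
    case (insert x M)
    have "(\<Sum>Q\<in>Pow (insert x M). (real (card Q) - card (insert x M) / 2)\<^sup>2)
        = (\<Sum>Q\<in>Pow M. 2 * (real (card Q) - card M / 2)\<^sup>2 + 1 / 2)"
      unfolding sum_Pow_insert[OF insert.hyps(1,2)]
    proof (rule sum.cong)
      fix Q assume "Q \<in> Pow M"
      then have "real (card (insert x Q)) = real (card Q) + 1" "real (card (insert x M)) = real (card M) + 1"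
        using card[OF insert.hyps(1,2)] insert.hyps by auto
      then show "(real (card Q) - card (insert x M) / 2)\<^sup>2
          + (real (card (insert x Q)) - card (insert x M) / 2)\<^sup>2
          = 2 * (real (card Q) - card M / 2)\<^sup>2 + 1 / 2"
        by (simp only:) (simp add: power2_eq_square field_simps)
    qed simp
    also have "\<dots> = card (insert x M) / 4 * 2 ^ card (insert x M)"
      unfolding sum.distrib sum_distrib_left[symmetric] insert.IH
      using insert.hyps by (simp add: card_Pow field_simps)
    finally show ?case .
  qed simp
qed

text \<open>The deviation splits as u + v with u from \<open>F\<close> and v from \<open>M\<close>.
  As the event constrains \<open>F\<close> alone, v is summed over all subsets of \<open>M\<close>:
  its sum vanishes, which also kills the cross term of the square, and its second moment is the full
  binomial one. What remains is controlled by |u| \<le> |F|/2.\<close>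

lemma moments_of_fringe_event:
  fixes F M :: "'a set" and q :: "'a set \<Rightarrow> bool"
  assumes "finite F" "finite M" "F \<inter> M = {}"
  defines "H \<equiv> {A \<in> Pow (F \<union> M). q (A \<inter> F)}"
    and "X \<equiv> \<lambda>A. real (card A) - card (F \<union> M) / 2"
  shows "\<bar>\<Sum>A\<in>H. X A\<bar> \<le> card F / 2 * 2 ^ card (F \<union> M)"
    and "\<bar>(\<Sum>A\<in>H. (X A)\<^sup>2) - card H * (card M / 4)\<bar> \<le> (card F / 2)\<^sup>2 * 2 ^ card (F \<union> M)"
proof -
  define u where "u P = real (card P) - card F / 2" for P :: "'a set"
  define v where "v Q = real (card Q) - card M / 2" for Q :: "'a set"
  define i where "i P = (of_bool (q P) :: real)" for P
  define m where "m = card M"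
  have cu: "card (F \<union> M) = card F + m" using assms(1-3) by (simp add: card_Un_disjoint m_def)
  have X: "X A = u (A \<inter> F) + v (A \<inter> M)" if "A \<in> Pow (F \<union> M)" for A
  proof -
    have "A = (A \<inter> F) \<union> (A \<inter> M)" using that by auto
    then have "card A = card (A \<inter> F) + card (A \<inter> M)"
      using assms(1-3) by (metis card_Un_disjoint finite_Int Int_assoc Int_left_commute inf_bot_right)
    then show ?thesis using cu by (simp add: X_def u_def v_def m_def field_simps)
  qed
  have H: "(\<Sum>A\<in>H. g (A \<inter> F) (A \<inter> M)) = (\<Sum>P\<in>Pow F. i P * (\<Sum>Q\<in>Pow M. g P Q))" for g
  proof -
    have "(\<Sum>A\<in>H. g (A \<inter> F) (A \<inter> M))
        = (\<Sum>A\<in>Pow (F \<union> M). i (A \<inter> F) * g (A \<inter> F) (A \<inter> M))"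
      unfolding H_def i_def by (rule sum.mono_neutral_cong_left) (use assms in auto)
    also have "\<dots> = (\<Sum>P\<in>Pow F. \<Sum>Q\<in>Pow M. i P * g P Q)"
      by (rule sum_Pow_Un[OF assms(1-3)])
    finally show ?thesis by (simp add: sum_distrib_left)
  qed
  have cM: "real (card (Pow M)) = 2 ^ m" using assms(2) by (simp add: card_Pow m_def)
  have sv: "(\<Sum>Q\<in>Pow M. v Q) = 0" "(\<Sum>Q\<in>Pow M. (v Q)\<^sup>2) = card M / 4 * 2 ^ m"
    using sum_Pow_card_centered[OF assms(2)] by (simp_all add: v_def m_def)
  have cardH: "real (card H) = (\<Sum>P\<in>Pow F. i P * 2 ^ m)"
    using H[of "\<lambda>_ _. 1"] cM by simp
  have u: "\<bar>u P\<bar> \<le> card F / 2" if "P \<in> Pow F" for P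
  proof -
    have "card P \<le> card F" using card_mono[OF assms(1)] that by auto
    then have "real (card P) \<le> real (card F)" "0 \<le> real (card P)" by simp_all
    then show ?thesis unfolding u_def by linarith
  qed
  have i: "0 \<le> i P" "i P \<le> 1" for P by (auto simp: i_def)
  have bound: "\<bar>\<Sum>P\<in>Pow F. i P * (2 ^ m * y P)\<bar> \<le> Y * 2 ^ card (F \<union> M)"
    if "\<And>P. P \<in> Pow F \<Longrightarrow> \<bar>y P\<bar> \<le> Y" for y Y
  proof -
    have "\<bar>\<Sum>P\<in>Pow F. i P * (2 ^ m * y P)\<bar> \<le> (\<Sum>P\<in>Pow F. 2 ^ m * Y)"
    proof (rule order_trans[OF sum_abs sum_mono])
      fix P assume "P \<in> Pow F"
      then have "i P * (2 ^ m * \<bar>y P\<bar>) \<le> 1 * (2 ^ m * Y)"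
        using that i by (intro mult_mono) auto
      then show "\<bar>i P * (2 ^ m * y P)\<bar> \<le> 2 ^ m * Y" using i by (simp add: abs_mult)
    qed
    then show ?thesis using assms(1) cu by (simp add: card_Pow power_add mult_ac)
  qed
  have "(\<Sum>A\<in>H. X A) = (\<Sum>A\<in>H. u (A \<inter> F) + v (A \<inter> M))"
    by (rule sum.cong) (auto simp: H_def X)
  also have "\<dots> = (\<Sum>P\<in>Pow F. i P * (2 ^ m * u P))"
    unfolding H[of "\<lambda>P Q. u P + v Q"] using cM by (simp add: sum.distrib sv)
  finally show "\<bar>\<Sum>A\<in>H. X A\<bar> \<le> card F / 2 * 2 ^ card (F \<union> M)"
    using bound[OF u] by simp
  have "(\<Sum>A\<in>H. (X A)\<^sup>2) = (\<Sum>A\<in>H. (u (A \<inter> F) + v (A \<inter> M))\<^sup>2)"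
    by (rule sum.cong) (auto simp: H_def X)
  also have "\<dots> = (\<Sum>P\<in>Pow F. i P * (2 ^ m * (u P)\<^sup>2 + card M / 4 * 2 ^ m))"
    unfolding H[of "\<lambda>P Q. (u P + v Q)\<^sup>2"]
  proof (rule sum.cong)
    fix P
    have "(\<Sum>Q\<in>Pow M. (u P + v Q)\<^sup>2)
        = (\<Sum>Q\<in>Pow M. (u P)\<^sup>2) + 2 * u P * (\<Sum>Q\<in>Pow M. v Q) + (\<Sum>Q\<in>Pow M. (v Q)\<^sup>2)"
      unfolding power2_sum sum_distrib_left sum.distrib by (simp add: mult_ac)
    then show "i P * (\<Sum>Q\<in>Pow M. (u P + v Q)\<^sup>2)
        = i P * (2 ^ m * (u P)\<^sup>2 + card M / 4 * 2 ^ m)"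
      using cM by (simp add: sv)
  qed simp
  also have "\<dots> = (\<Sum>P\<in>Pow F. i P * (2 ^ m * (u P)\<^sup>2)) + card H * (card M / 4)"
    unfolding cardH sum_distrib_right sum.distrib[symmetric]
    by (rule sum.cong) (simp_all add: algebra_simps)
  finally have "(\<Sum>A\<in>H. (X A)\<^sup>2) - card H * (card M / 4) = (\<Sum>P\<in>Pow F. i P * (2 ^ m * (u P)\<^sup>2))"
    by simp
  moreover have "\<bar>(u P)\<^sup>2\<bar> \<le> (card F / 2)\<^sup>2" if "P \<in> Pow F" for P
    using u[OF that] by (simp add: abs_le_square_iff[symmetric])
  ultimately show
    "\<bar>(\<Sum>A\<in>H. (X A)\<^sup>2) - card H * (card M / 4)\<bar> \<le> (card F / 2)\<^sup>2 * 2 ^ card (F \<union> M)"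
    using bound[of "\<lambda>P. (u P)\<^sup>2"] by simp
qed

text \<open>Common terms cancel, and the remaining terms of the two sums lie in disjoint subsets of
  \<open>E\<close>, so \<open>card E\<close> is counted once.\<close>

lemma abs_sum_diff_le:
  fixes f :: "'a \<Rightarrow> real" and Y :: real
  assumes "finite G" "finite H" "finite E" "G - E = H - E" "\<And>x. x \<in> G \<union> H \<Longrightarrow> \<bar>f x\<bar> \<le> Y" "0 \<le> Y"
  shows "\<bar>sum f G - sum f H\<bar> \<le> card E * Y"
proof -
  have split: "sum f Z = sum f (Z - E) + sum f (Z \<inter> E)" if "finite Z" for Z
    using that by (metis add.commute sum.Int_Diff)
  have "sum f G - sum f H = sum f (G \<inter> E) - sum f (H \<inter> E)"
    using split[OF assms(1)] split[OF assms(2)] assms(4) by simp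
  also have "\<dots> = sum f (G \<inter> E - H) - sum f (H \<inter> E - G)"
    using sum.Int_Diff[of "G \<inter> E" f H] sum.Int_Diff[of "H \<inter> E" f G] assms(1,2)
    by (simp add: Int_ac)
  finally have "\<bar>sum f G - sum f H\<bar> \<le> \<bar>sum f (G \<inter> E - H)\<bar> + \<bar>sum f (H \<inter> E - G)\<bar>"
    by simp
  also have "\<dots> \<le> card (G \<inter> E - H) * Y + card (H \<inter> E - G) * Y"
    by (intro add_mono order_trans[OF sum_abs sum_bounded_above]) (use assms(5) in auto)
  also have "\<dots> = card ((G \<inter> E - H) \<union> (H \<inter> E - G)) * Y"
    using assms(1,2) by (subst card_Un_disjoint) (auto simp: algebra_simps)
  also have "\<dots> \<le> card E * Y"
    using assms(3,6) by (intro mult_right_mono of_nat_mono card_mono) auto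
  finally show ?thesis .
qed

section \<open>Passage to the conditional distribution\<close>

lemma cond_pmf_of_set:
  assumes "finite A" "A \<inter> B \<noteq> {}"
  shows "cond_pmf (pmf_of_set A) B = pmf_of_set (A \<inter> B)"
proof (rule pmf_eqI)
  fix x
  have A: "A \<noteq> {}" using assms(2) by auto
  have "set_pmf (pmf_of_set A) \<inter> B \<noteq> {}" using assms A by simp
  then have "pmf (cond_pmf (pmf_of_set A) B) x
      = (if x \<in> B then pmf (pmf_of_set A) x / measure (pmf_of_set A) B else 0)"
    by (rule pmf_cond)
  then show "pmf (cond_pmf (pmf_of_set A) B) x = pmf (pmf_of_set (A \<inter> B)) x"
    using assms A by (auto simp: measure_pmf_of_set indicator_def)
qed

lemma expectation_conditioned_subset:
  fixes f :: "int set \<Rightarrow> real" and n :: nat and \<Lambda> :: "(int \<times> int) set"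
  defines "G \<equiv> {A \<in> Pow {0..int n}. missing n A \<in> \<Lambda>}"
  assumes "G \<noteq> {}"
  shows "measure_pmf.expectation (conditioned_subset \<Lambda> n) f = (\<Sum>A\<in>G. f A) / card G"
proof -
  have G: "Pow {0..int n} \<inter> {A. missing n A \<in> \<Lambda>} = G" by (auto simp: G_def)
  have "conditioned_subset \<Lambda> n = pmf_of_set G"
    unfolding conditioned_subset_def random_subset_def G[symmetric]
    by (rule cond_pmf_of_set) (use assms G in auto)
  moreover have "finite G" by (simp add: G_def)
  ultimately show ?thesis using assms(2) by (simp add: integral_pmf_of_set)
qed

text \<open>Up to the rare sets that are not well spread, the conditioning event depends only on
  the k smallest and the k largest elements of the interval.\<close>

lemma moments_missing_event:
  fixes n k :: nat and \<Lambda> :: "(int \<times> int) set"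
  defines "G \<equiv> {A \<in> Pow {0..int n}. missing n A \<in> \<Lambda>}"
    and "X \<equiv> \<lambda>A :: int set. real (card A) - (real n + 1) / 2"
  assumes n: "n \<ge> 1" and k: "2 * k \<le> n + 1" "k \<le> n" and small: "(7/8 :: real) ^ k \<le> 1 / n ^ 3"
  shows "\<bar>\<Sum>A\<in>G. X A\<bar> \<le> (real k + 24) * 2 ^ (n + 1)"
    and "\<bar>(\<Sum>A\<in>G. (X A)\<^sup>2) - card G * ((real n + 1) / 4)\<bar>
           \<le> ((real k)\<^sup>2 + k + 48) * 2 ^ (n + 1)"
proof -
  define F where "F = {0..<int k} \<union> {int n - int k<..int n}"
  define M where "M = {int k..int n - int k}"
  define R where "R A = (\<lambda>x. int n - x) ` A" for A :: "int set"
  define q where "q P \<longleftrightarrow> fringe_missing (int k) P (R P) \<in> \<Lambda>" for P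
  define H where "H = {A \<in> Pow (F \<union> M). q (A \<inter> F)}"
  define E where "E = {A \<in> Pow {0..int n}. \<not> well_spread n k A}"
  have FM: "F \<union> M = {0..int n}" "F \<inter> M = {}" "finite F" "finite M"
    using k by (auto simp: F_def M_def)
  have card_FM: "card (F \<union> M) = n + 1" unfolding FM(1) by (simp add: nat_add_distrib)
  have card_F: "card F = 2 * k"
    unfolding F_def using k by (subst card_Un_disjoint) auto
  have card_M: "real (card M) = real n + 1 - 2 * real k"
    using card_Un_disjoint[OF FM(3,4,2)] card_FM card_F by simp
  have "missing n A \<in> \<Lambda> \<longleftrightarrow> q (A \<inter> F)" if A: "A \<subseteq> {0..int n}" "well_spread n k A" for A
  proof -
    have "missing n A = fringe_missing (int k) A (R A)"
      unfolding R_def by (rule missing_eq_fringe_missing[OF A(1) k(2) A(2)])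
    also have "\<dots> = fringe_missing (int k) (A \<inter> F) (R (A \<inter> F))"
    proof (rule fringe_missing_cong)
      show "A \<inter> {..<int k} = A \<inter> F \<inter> {..<int k}"
        using A k by (auto simp: F_def)
      show "R A \<inter> {..<int k} = R (A \<inter> F) \<inter> {..<int k}"
        using A k by (auto simp: F_def R_def)
    qed (use A in \<open>auto simp: R_def\<close>)
    finally show ?thesis by (simp add: q_def)
  qed
  then have GH: "G - E = H - E" by (auto simp: G_def H_def E_def FM(1))
  have fin: "finite G" "finite H" "finite E" by (simp_all add: G_def H_def E_def FM)
  \<comment> \<open>Everything that is summed over exceptional sets below is at most n^3, so their
    total weight is at most 24 * 2^(n+1) each time.\<close>
  have cE: "card E * y \<le> 24 * 2 ^ (n + 1)" if "0 \<le> y" "y \<le> real n ^ 3" for y :: real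
  proof -
    have "real (card E) \<le> 24 * (1 / n ^ 3) * 2 ^ (n + 1)"
      unfolding E_def by (rule order_trans[OF card_not_well_spread_le])
        (intro mult_right_mono mult_left_mono small; simp)
    then have "card E * y \<le> 24 * (1 / n ^ 3) * 2 ^ (n + 1) * (real n ^ 3)"
      using that by (intro mult_mono) auto
    then show ?thesis using n by simp
  qed
  have n1: "1 \<le> real n" using n by simp
  have n3: "real n \<le> real n ^ 3" "(real n)\<^sup>2 \<le> real n ^ 3"
    using power_increasing[of 1 3 "real n"] power_increasing[of 2 3 "real n"] n1 by simp_all
  have Xn: "\<bar>X A\<bar> \<le> real n" if "A \<in> G \<union> H" for A
  proof -
    have "A \<subseteq> {0..int n}" using that FM(1) by (auto simp: G_def H_def)
    then have "card A \<le> n + 1" using card_mono[of "{0..int n}" A] by simp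
    then show ?thesis using n by (auto simp: X_def abs_le_iff field_simps)
  qed
  have X2: "\<bar>(X A)\<^sup>2\<bar> \<le> (real n)\<^sup>2" if "A \<in> G \<union> H" for A
    using Xn[OF that] by (simp add: abs_le_square_iff[symmetric])
  have X_eq: "X A = real (card A) - card (F \<union> M) / 2" for A
    unfolding X_def card_FM by simp
  have H1: "\<bar>\<Sum>A\<in>H. X A\<bar> \<le> k * 2 ^ (n + 1)"
    using moments_of_fringe_event(1)[OF FM(3,4,2), of q]
    unfolding H_def[symmetric] X_eq[symmetric] unfolding card_FM card_F by simp
  have H2: "\<bar>(\<Sum>A\<in>H. (X A)\<^sup>2) - card H * (card M / 4)\<bar> \<le> (real k)\<^sup>2 * 2 ^ (n + 1)"
    using moments_of_fringe_event(2)[OF FM(3,4,2), of q]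
    unfolding H_def[symmetric] X_eq[symmetric] unfolding card_FM card_F by simp
  have d1: "\<bar>(\<Sum>A\<in>G. X A) - (\<Sum>A\<in>H. X A)\<bar> \<le> 24 * 2 ^ (n + 1)"
    using abs_sum_diff_le[OF fin GH Xn] cE[of n] n3 by fastforce
  show "\<bar>\<Sum>A\<in>G. X A\<bar> \<le> (real k + 24) * 2 ^ (n + 1)"
    using H1 d1 by (simp add: algebra_simps)
  have d2: "\<bar>(\<Sum>A\<in>G. (X A)\<^sup>2) - (\<Sum>A\<in>H. (X A)\<^sup>2)\<bar> \<le> 24 * 2 ^ (n + 1)"
    using abs_sum_diff_le[OF fin GH X2] cE[of "(real n)\<^sup>2"] n3 by fastforce
  \<comment> \<open>Comparing sums of a constant compares the cardinalities of \<open>G\<close> and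
    \<open>H\<close>.\<close>
  have "\<bar>(\<Sum>A\<in>G. card M / 4) - (\<Sum>A\<in>H. card M / 4)\<bar> \<le> card E * (card M / 4)"
    by (rule abs_sum_diff_le[OF fin GH]) auto
  also have "\<dots> \<le> 24 * 2 ^ (n + 1)"
  proof (rule cE)
    show "card M / 4 \<le> real n ^ 3" using card_M n1 n3(1) by linarith
  qed simp
  finally have d3: "\<bar>card G * (card M / 4) - card H * (card M / 4)\<bar> \<le> 24 * 2 ^ (n + 1)"
    by simp
  have "card G \<le> card (Pow {0..int n})" by (rule card_mono) (auto simp: G_def)
  then have "card G \<le> 2 ^ (n + 1)" by (simp add: card_Pow nat_add_distrib)
  then have "real (card G) \<le> 2 ^ (n + 1)" by (metis of_nat_le_iff of_nat_numeral of_nat_power)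
  then have "real (card G) * (real k / 2) \<le> 2 ^ (n + 1) * real k"
    by (intro mult_mono) auto
  moreover have "(real n + 1) / 4 = card M / 4 + real k / 2"
    unfolding card_M by (simp add: field_simps)
  then have "card G * ((real n + 1) / 4) = card G * (card M / 4) + card G * (real k / 2)"
    by (simp only: distrib_left)
  moreover have "0 \<le> card G * (real k / 2)" by simp
  ultimately have d4: "\<bar>card G * (card M / 4) - card G * ((real n + 1) / 4)\<bar> \<le> 2 ^ (n + 1) * real k"
    by linarith
  \<comment> \<open>The errors in order: k^2 from the fringe deviation, 24 for exceptional sets in
    the second moment, 24 for them in the cardinality, and k from the 2k elements of the interval
    outside \<open>M\<close>.\<close>
  have "\<bar>(\<Sum>A\<in>G. (X A)\<^sup>2) - card G * ((real n + 1) / 4)\<bar>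
      \<le> (real k)\<^sup>2 * 2 ^ (n + 1) + 24 * 2 ^ (n + 1) + 24 * 2 ^ (n + 1) + 2 ^ (n + 1) * real k"
    using H2 d2 d3 d4 by linarith
  then show "\<bar>(\<Sum>A\<in>G. (X A)\<^sup>2) - card G * ((real n + 1) / 4)\<bar>
      \<le> ((real k)\<^sup>2 + k + 48) * 2 ^ (n + 1)"
    by (simp add: algebra_simps)
qed

section \<open>Choice of the fringe length and final estimates\<close>

theorem proposition5p6:
  fixes \<Lambda> :: "(int \<times> int) set"
  assumes "\<Lambda> \<subseteq> {0..} \<times> {0..}"
    and "\<exists>s d. (s, d) \<in> \<Lambda> \<and> even d"
  shows "(\<lambda>n. measure_pmf.expectation (conditioned_subset \<Lambda> n) (\<lambda>A. real (card A))
              - (real n + 1) / 2) \<in> O(\<lambda>n. ln (real n))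
    \<and> (\<lambda>n. measure_pmf.variance (conditioned_subset \<Lambda> n) (\<lambda>A. real (card A))
              - (real n + 1) / 4) \<in> O(\<lambda>n. (ln (real n))\<^sup>2)"
proof -
  obtain s d where sd: "(s, d) \<in> \<Lambda>" "even d" using assms(2) by blast
  then have "s \<ge> 0" "d \<ge> 0" using assms(1) by auto
  with sd obtain s' e where se: "s = int s'" "d = 2 * int e"
    by (metis evenE nonneg_int_cases zero_le_mult_iff zero_le_numeral not_numeral_le_zero)
  obtain c :: real and n0 where c: "c > 0" and n0: "\<And>n. n \<ge> n0 \<Longrightarrow>
      c * 2 ^ (n + 1) \<le> real (card {S \<in> Pow {0..int n}. missing n S = (int s', 2 * int e)})"
    by (rule card_missing_eq_ge[of s' e]) blast
  \<comment> \<open>With k \<le> 25 ln n and ln n \<ge> 1, the first moment bound gives 49 = 25 + 24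
    and the second 698 = 25^2 + 25 + 48. The square of 49/c comes from the shift of the
    mean.\<close>
  define C where "C = 698 / c + (49 / c)\<^sup>2"
  \<comment> \<open>This leaves room for two fringes: 2k \<le> 48 ln n + 2 \<le> n + 1 as soon as 49
    ln n < n and ln n \<ge> 1. The latter holds from n = 3 on, since e \<le> 3.\<close>
  have "eventually (\<lambda>n. ln (real n) / real n < 1 / 49) sequentially"
    using lim_ln_over_n by (rule order_tendstoD) simp
  then have "eventually (\<lambda>n. \<bar>measure_pmf.expectation (conditioned_subset \<Lambda> n) (\<lambda>A. real (card A))
              - (real n + 1) / 2\<bar> \<le> 49 / c * \<bar>ln (real n)\<bar> \<and>
      \<bar>measure_pmf.variance (conditioned_subset \<Lambda> n) (\<lambda>A. real (card A))
              - (real n + 1) / 4\<bar> \<le> C * \<bar>(ln (real n))\<^sup>2\<bar>) sequentially"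
    using eventually_ge_at_top[of n0] eventually_ge_at_top[of 3]
  proof eventually_elim
    case (elim n)
    define L where "L = ln (real n)"
    \<comment> \<open>Since 7/8 \<le> exp (-1/8), the exponent 24 ln n = 8 * 3 ln n yields the rate
      n^-3.\<close>
    define k where "k = nat \<lceil>24 * L\<rceil>"
    define G where "G = {A \<in> Pow {0..int n}. missing n A \<in> \<Lambda>}"
    define X where "X A = real (card A) - (real n + 1) / 2" for A :: "int set"
    have "exp 1 \<le> real n" using exp_le elim(3) by linarith
    then have L: "L \<ge> 1" using elim(3) by (simp add: L_def ln_ge_iff)
    have Ln: "49 * L < n" using elim(1,3) by (simp add: L_def field_simps)
    have k1: "24 * L \<le> k" and k3: "k \<le> 24 * L + 1"
      using L by (simp_all add: k_def real_nat_ceiling_ge of_int_ceiling_le_add_one)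
    from k3 have k2: "k \<le> 25 * L" using L by linarith
    have "real (2 * k) \<le> real (n + 1)" "real k \<le> real n" using k3 L Ln by auto
    then have kn: "2 * k \<le> n + 1" "k \<le> n" by (simp_all only: of_nat_le_iff)
    have "(7/8 :: real) ^ k \<le> exp (- 1/8) ^ k"
      using exp_ge_add_one_self[of "- 1/8"] by (intro power_mono) auto
    also have "\<dots> = exp (- k / 8)" by (simp add: exp_of_nat_mult[symmetric])
    also have "\<dots> \<le> exp (- (3 * L))" using k1 by simp
    also have "\<dots> = 1 / n ^ 3"
      using elim(3) exp_of_nat_mult[of 3 L] by (simp add: exp_minus L_def field_simps)
    finally have small: "(7/8 :: real) ^ k \<le> 1 / n ^ 3" .
    have sub: "{S \<in> Pow {0..int n}. missing n S = (int s', 2 * int e)} \<subseteq> G"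
      using sd se by (auto simp: G_def)
    have fin: "finite G" by (simp add: G_def)
    have cG: "c * 2 ^ (n + 1) \<le> card G"
      using n0[OF elim(2)] card_mono[OF fin sub] by linarith
    have pos: "0 < real (card G)" using c by (intro less_le_trans[OF _ cG]) simp
    then have ne: "G \<noteq> {}" by auto
    \<comment> \<open>The positive density of \<open>G\<close> enters here: normalising by
      \<open>card G\<close> instead of 2^(n+1) costs the factor 1/c.\<close>
    have avg: "\<bar>z / card G\<bar> \<le> y / c" if "\<bar>z\<bar> \<le> y * 2 ^ (n + 1)" "0 \<le> y" for y z
    proof -
      have "c * \<bar>z\<bar> \<le> y * (c * 2 ^ (n + 1))"
        using mult_left_mono[OF that(1), of c] c by (simp add: mult_ac)
      also have "\<dots> \<le> y * card G" using cG that(2) by (rule mult_left_mono)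
      finally show ?thesis using pos c by (simp add: field_simps)
    qed
    have n: "n \<ge> 1" using elim(3) by simp
    note mom = moments_missing_event[OF n kn small, of \<Lambda>, folded G_def, folded X_def]
    define a where "a = (\<Sum>A\<in>G. X A) / card G"
    define b where "b = (\<Sum>A\<in>G. (X A)\<^sup>2) / card G"
    have "\<bar>a\<bar> \<le> (real k + 24) / c" unfolding a_def by (rule avg[OF mom(1)]) simp
    also have "\<dots> \<le> (49 * L) / c" using k2 L c by (intro divide_right_mono) auto
    finally have a: "\<bar>a\<bar> \<le> 49 / c * L" by simp
    have "\<bar>((\<Sum>A\<in>G. (X A)\<^sup>2) - card G * ((real n + 1) / 4)) / card G\<bar>
        \<le> ((real k)\<^sup>2 + k + 48) / c"
      by (rule avg[OF mom(2)]) simp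
    also have "((\<Sum>A\<in>G. (X A)\<^sup>2) - card G * ((real n + 1) / 4)) / card G = b - (real n + 1) / 4"
      using pos by (simp add: b_def diff_divide_distrib)
    also have "((real k)\<^sup>2 + k + 48) / c \<le> (698 * L\<^sup>2) / c"
    proof (intro divide_right_mono)
      have "(real k)\<^sup>2 \<le> (25 * L)\<^sup>2" using k2 by (intro power_mono) auto
      moreover have "L \<le> L\<^sup>2" "1 \<le> L\<^sup>2" using L by (simp_all add: power2_eq_square mult_ge1_I)
      ultimately show "(real k)\<^sup>2 + k + 48 \<le> 698 * L\<^sup>2" using k2 by (simp add: power_mult_distrib)
    qed (use c in simp)
    finally have b: "\<bar>b - (real n + 1) / 4\<bar> \<le> 698 / c * L\<^sup>2" by simp
    have "a\<^sup>2 \<le> (49 / c * L)\<^sup>2" using a by (metis abs_ge_zero power2_abs power_mono)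
    then have a2: "a\<^sup>2 \<le> (49 / c)\<^sup>2 * L\<^sup>2" by (simp only: power_mult_distrib)
    note ex = expectation_conditioned_subset[of n \<Lambda>, folded G_def, OF ne]
    have mean: "measure_pmf.expectation (conditioned_subset \<Lambda> n) (\<lambda>A. real (card A))
        = a + (real n + 1) / 2"
      unfolding ex using pos by (simp add: a_def X_def sum_subtractf diff_divide_distrib)
    \<comment> \<open>Moments were taken about (n+1)/2 rather than the conditional mean; recentering
      by \<open>a\<close> subtracts a^2, which is of order (ln n)^2.\<close>
    have "measure_pmf.variance (conditioned_subset \<Lambda> n) (\<lambda>A. real (card A))
        = (\<Sum>A\<in>G. (X A - a)\<^sup>2) / card G"
      unfolding mean ex by (simp add: X_def algebra_simps)
    also have "(\<Sum>A\<in>G. (X A - a)\<^sup>2) = (\<Sum>A\<in>G. (X A)\<^sup>2 - 2 * a * X A + a\<^sup>2)"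
      by (simp add: power2_diff algebra_simps)
    also have "\<dots> = (\<Sum>A\<in>G. (X A)\<^sup>2) - 2 * a * (\<Sum>A\<in>G. X A) + card G * a\<^sup>2"
      by (simp add: sum.distrib sum_subtractf sum_distrib_left)
    also have "\<dots> / card G = b - 2 * a * a + a\<^sup>2"
      using pos by (simp add: a_def b_def add_divide_distrib diff_divide_distrib)
    finally have var: "measure_pmf.variance (conditioned_subset \<Lambda> n) (\<lambda>A. real (card A)) = b - a\<^sup>2"
      by (simp add: power2_eq_square)
    have "\<bar>b - a\<^sup>2 - (real n + 1) / 4\<bar> \<le> C * L\<^sup>2"
      using b a2 zero_le_power2[of a] unfolding C_def distrib_right by linarith
    with a show ?case unfolding var unfolding mean L_def[symmetric] using L by simp
  qed
  then show ?thesis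
    unfolding eventually_conj_iff real_norm_def[symmetric]
    by (elim conjE, intro conjI) (erule bigoI)+
qed

end
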